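(* Let $M\rightarrow M'$ be a matroid perspective on a finite linearly ordered set $E$. Define $\phi^*_{M,M'},\phi_{M,M'}:2^E\to 2^E$ by $\phi^*_{M,M'}(A)=(A\cup P_{M'}(A))\setminus\mathrm{Int}_{M'}(A)$ and $\phi_{M,M'}(A)=(A\setminus Q_M(A))\cup\mathrm{Ext}_M(A)$. Then both are involutions of $2^E$; $\phi^*_{M,M'}$ exchanges corank in $M'$ and internal activity in $M'$, i.e. $cr_{M'}(\phi^*_{M,M'}(A))=\iota_{M'}(A)$ and $\iota_{M'}(\phi^*_{M,M'}(A))=cr_{M'}(A)$, and $\phi_{M,M'}$ exchanges nullity in $M$ and external activity in $M$, i.e. $nl_M(\phi_{M,M'}(A))=\epsilon_M(A)$ and $\epsilon_M(\phi_{M,M'}(A))=nl_M(A)$, for all $A\subseteq E$.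
   Context: A matroid perspective $M\rightarrow M'$ is a pair of matroids $M,M'$ on the same finite set $E$ such that every circuit of $M$ is a union of circuits of $M'$. For a matroid $N$ on $E$ with rank function $r_N$, $r(N)=r_N(E)$, and $A\subseteq E$: $P_N(A)$ is the set of $e\in E\setminus A$ that are the smallest element of some cocircuit of $N$ contained in $E\setminus A$; $Q_N(A)$ is the set of $e\in A$ that are the smallest element of some circuit of $N$ contained in $A$; $\mathrm{Ext}_N(A)$ is the set of $e\in E\setminus A$ that are the smallest element of some circuit of $N$ contained in $A\cup\{e\}$, $\epsilon_N(A)=|\mathrm{Ext}_N(A)|$; $\mathrm{Int}_N(A)$ is the set of $e\in A$ that are the smallest element of some cocircuit of $N$ contained in $(E\setminus A)\cup\{e\}$, $\iota_N(A)=|\mathrm{Int}_N(A)|$; $cr_N(A)=r(N)-r_N(A)$ $(=|P_N(A)|)$ and $nl_N(A)=|A|-r_N(A)$ $(=|Q_N(A)|)$. *)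

theory Defs
  imports Main
begin

text \<open>A matroid on the ground set \<open>E\<close> is represented by its family \<open>I\<close> of independent sets.\<close>

locale matroid =
  fixes E :: "'a set" and I :: "'a set set"
  assumes finite_ground: "finite E"
    and indep_subset_ground: "X \<in> I \<Longrightarrow> X \<subseteq> E"
    and empty_indep: "{} \<in> I"
    and indep_subset: "X \<in> I \<Longrightarrow> Y \<subseteq> X \<Longrightarrow> Y \<in> I"
    and augment: "X \<in> I \<Longrightarrow> Y \<in> I \<Longrightarrow> card X < card Y \<Longrightarrow> \<exists>y\<in>Y - X. insert y X \<in> I"

definition matroid_rank :: "'a set set \<Rightarrow> 'a set \<Rightarrow> nat" where
  "matroid_rank I A = Max (card ` {X \<in> I. X \<subseteq> A})"

definition bases :: "'a set set \<Rightarrow> 'a set set" where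
  "bases I = {B \<in> I. \<forall>X\<in>I. B \<subseteq> X \<longrightarrow> X = B}"

definition circuits :: "'a set \<Rightarrow> 'a set set \<Rightarrow> 'a set set" where
  "circuits E I = {C. C \<subseteq> E \<and> C \<notin> I \<and> (\<forall>D. D \<subset> C \<longrightarrow> D \<in> I)}"

definition dual :: "'a set \<Rightarrow> 'a set set \<Rightarrow> 'a set set" where
  "dual E I = {X. \<exists>B\<in>bases I. X \<subseteq> E - B}"

definition cocircuits :: "'a set \<Rightarrow> 'a set set \<Rightarrow> 'a set set" where
  "cocircuits E I = circuits E (dual E I)"

definition matroid_perspective :: "'a set \<Rightarrow> 'a set set \<Rightarrow> 'a set set \<Rightarrow> bool" where
  "matroid_perspective E M M' \<longleftrightarrow> matroid E M \<and> matroid E M' \<and>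
     (\<forall>C\<in>circuits E M. \<exists>\<D> \<subseteq> circuits E M'. C = \<Union>\<D>)"

definition smallest_in :: "'a::linorder \<Rightarrow> 'a set \<Rightarrow> bool" where
  "smallest_in e C \<longleftrightarrow> e \<in> C \<and> (\<forall>x\<in>C. e \<le> x)"

definition P_set :: "'a::linorder set \<Rightarrow> 'a set set \<Rightarrow> 'a set \<Rightarrow> 'a set" where
  "P_set E N A = {e \<in> E - A. \<exists>C\<in>cocircuits E N. C \<subseteq> E - A \<and> smallest_in e C}"

definition Q_set :: "'a::linorder set \<Rightarrow> 'a set set \<Rightarrow> 'a set \<Rightarrow> 'a set" where
  "Q_set E N A = {e \<in> A. \<exists>C\<in>circuits E N. C \<subseteq> A \<and> smallest_in e C}"

definition Ext_set :: "'a::linorder set \<Rightarrow> 'a set set \<Rightarrow> 'a set \<Rightarrow> 'a set" where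
  "Ext_set E N A = {e \<in> E - A. \<exists>C\<in>circuits E N. C \<subseteq> A \<union> {e} \<and> smallest_in e C}"

definition Int_set :: "'a::linorder set \<Rightarrow> 'a set set \<Rightarrow> 'a set \<Rightarrow> 'a set" where
  "Int_set E N A = {e \<in> A. \<exists>C\<in>cocircuits E N. C \<subseteq> (E - A) \<union> {e} \<and> smallest_in e C}"

definition ext_activity :: "'a::linorder set \<Rightarrow> 'a set set \<Rightarrow> 'a set \<Rightarrow> nat" where
  "ext_activity E N A = card (Ext_set E N A)"

definition int_activity :: "'a::linorder set \<Rightarrow> 'a set set \<Rightarrow> 'a set \<Rightarrow> nat" where
  "int_activity E N A = card (Int_set E N A)"

text \<open>Corank and nullity are integer-valued, so that no truncated subtraction is involved.\<close>

definition corank :: "'a set \<Rightarrow> 'a set set \<Rightarrow> 'a set \<Rightarrow> int" where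
  "corank E N A = int (matroid_rank N E) - int (matroid_rank N A)"

definition nullity :: "'a set set \<Rightarrow> 'a set \<Rightarrow> int" where
  "nullity N A = int (card A) - int (matroid_rank N A)"

definition phi_star :: "'a::linorder set \<Rightarrow> 'a set set \<Rightarrow> 'a set set \<Rightarrow> 'a set \<Rightarrow> 'a set" where
  "phi_star E M M' A = (A \<union> P_set E M' A) - Int_set E M' A"

definition phi :: "'a::linorder set \<Rightarrow> 'a set set \<Rightarrow> 'a set set \<Rightarrow> 'a set \<Rightarrow> 'a set" where
  "phi E M M' A = (A - Q_set E M A) \<union> Ext_set E M A"

definition involution_on :: "'b set \<Rightarrow> ('b \<Rightarrow> 'b) \<Rightarrow> bool" where
  "involution_on S f \<longleftrightarrow> (\<forall>x\<in>S. f x \<in> S \<and> f (f x) = x)"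

end

theory Submission
  imports Defs
begin

text \<open>
  Call \<open>e \<in> E\<close> \<^emph>\<open>active\<close> for \<open>A\<close> if \<open>e\<close> lies in the closure of the elements of \<open>A\<close> above \<open>e\<close>.
  Writing \<open>act A\<close> for the set of active elements, \<open>Q A = A \<inter> act A\<close> and \<open>Ext A = act A - A\<close>, so
  \<open>\<phi> A\<close> is the symmetric difference of \<open>A\<close> and \<open>act A\<close>. Adding active elements to \<open>A\<close> or deleting
  them from it does not change the closure of any upper segment of \<open>A\<close>, hence does not change
  \<open>act A\<close>. Thus \<open>\<phi>\<close> is an involution that swaps \<open>Q\<close> and \<open>Ext\<close>. Moreover \<open>A - act A\<close> is
  independent and spans \<open>A\<close>, so \<open>Q A\<close> has as many elements as the nullity of \<open>A\<close>. The map \<open>\<phi>\<^sup>*\<close> is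
  \<open>\<phi>\<close> for the dual matroid, conjugated by complementation.
\<close>

text \<open>Matroid closure phrased by independent sets instead of rank, which makes monotonicity
  immediate. The disjunct \<open>e \<in> S\<close> covers elements of \<open>S\<close> that no
  independent subset of \<open>S\<close> makes dependent, such as coloops.\<close>

definition closure_in :: "'a set \<Rightarrow> 'a set set \<Rightarrow> 'a set \<Rightarrow> 'a set" where
  "closure_in E I S = {e \<in> E. e \<in> S \<or> (\<exists>X\<in>I. X \<subseteq> S \<and> insert e X \<notin> I)}"

text \<open>Maximality under adding single elements is the form that \<open>augment\<close>
  contradicts directly.\<close>

definition basis_of :: "'a set set \<Rightarrow> 'a set \<Rightarrow> 'a set \<Rightarrow> bool" where
  "basis_of I S X \<longleftrightarrow> X \<in> I \<and> X \<subseteq> S \<and> (\<forall>e\<in>S. insert e X \<in> I \<longrightarrow> e \<in> X)"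

text \<open>The open segment \<open>{e<..}\<close> leaves out \<open>e\<close> itself, so whether
  \<open>e\<close> is active does not depend on whether it belongs to \<open>A\<close>.\<close>

definition active_set :: "'a::linorder set \<Rightarrow> 'a set set \<Rightarrow> 'a set \<Rightarrow> 'a set" where
  "active_set E I A = {e \<in> E. e \<in> closure_in E I (A \<inter> {e<..})}"

section \<open>Bases, rank and closure\<close>

context matroid
begin

lemma finite_indep: "X \<in> I \<Longrightarrow> finite X"
  using finite_ground finite_subset indep_subset_ground by blast

lemma indep_extends_to_basis:
  assumes "X \<in> I" "X \<subseteq> S"
  obtains B where "basis_of I S B" "X \<subseteq> B"
proof -
  let ?F = "{Y \<in> I. X \<subseteq> Y \<and> Y \<subseteq> S}"
  have "?F \<subseteq> Pow E" using indep_subset_ground by blast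
  then have "finite ?F" using finite_ground finite_subset by blast
  moreover have "X \<in> ?F" using assms by blast
  ultimately obtain B where B: "B \<in> ?F" "\<And>Y. Y \<in> ?F \<Longrightarrow> B \<subseteq> Y \<Longrightarrow> Y = B"
    using finite_has_maximal[of ?F] by (metis (no_types, lifting) empty_iff)
  have "e \<in> B" if "e \<in> S" "insert e B \<in> I" for e
    using B(2)[of "insert e B"] that B(1) by blast
  then have "basis_of I S B" using B(1) unfolding basis_of_def by blast
  with B(1) show ?thesis using that by blast
qed

lemma basis_exists: obtains B where "basis_of I S B"
  using indep_extends_to_basis[OF empty_indep, of S] by blast

lemma card_indep_le_basis:
  assumes "basis_of I S B" "X \<in> I" "X \<subseteq> S"
  shows "card X \<le> card B"
proof (rule ccontr)
  assume "\<not> card X \<le> card B"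
  then obtain y where "y \<in> X - B" "insert y B \<in> I"
    using augment[of B X] assms unfolding basis_of_def by auto
  then show False using assms unfolding basis_of_def by blast
qed

lemma card_basis_eq: "basis_of I S B \<Longrightarrow> basis_of I S B' \<Longrightarrow> card B = card B'"
  by (meson basis_of_def card_indep_le_basis le_antisym)

lemma rank_eq_card_basis:
  assumes "basis_of I S B"
  shows "matroid_rank I S = card B"
  unfolding matroid_rank_def
proof (rule Max_eqI)
  have "{X \<in> I. X \<subseteq> S} \<subseteq> Pow E" using indep_subset_ground by blast
  then show "finite (card ` {X \<in> I. X \<subseteq> S})"
    using finite_ground finite_subset by blast
  show "card B \<in> card ` {X \<in> I. X \<subseteq> S}"
    using assms unfolding basis_of_def by blast
qed (use card_indep_le_basis[OF assms] in blast)

lemma card_indep_le_rank: "X \<in> I \<Longrightarrow> X \<subseteq> S \<Longrightarrow> card X \<le> matroid_rank I S"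
  using basis_exists[of S] rank_eq_card_basis card_indep_le_basis by metis

lemma bases_iff: "B \<in> bases I \<longleftrightarrow> basis_of I E B"
proof
  assume "B \<in> bases I"
  then show "basis_of I E B"
    using indep_subset_ground unfolding bases_def basis_of_def by blast
next
  assume B: "basis_of I E B"
  have "X = B" if "X \<in> I" "B \<subseteq> X" for X
  proof -
    have "x \<in> B" if "x \<in> X" for x
      using B indep_subset[OF \<open>X \<in> I\<close>, of "insert x B"] that \<open>B \<subseteq> X\<close>
        indep_subset_ground[OF \<open>X \<in> I\<close>]
      unfolding basis_of_def by blast
    then show ?thesis using that by blast
  qed
  then show "B \<in> bases I" using B unfolding bases_def basis_of_def by blast
qed

text \<open>One basis decides the closure. If \<open>X\<close> makes \<open>e\<close> dependent but
  \<open>B\<close> does not, extend \<open>X\<close> to a basis \<open>X'\<close> of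
  \<open>S\<close>; then \<open>insert e B\<close> is larger than \<open>X'\<close>. Augmenting
  \<open>X'\<close> from it adds \<open>e\<close>, against dependence, or an element of
  \<open>S\<close>, against maximality.\<close>

lemma in_closure_iff:
  assumes B: "basis_of I S B" and e: "e \<in> E"
  shows "e \<in> closure_in E I S \<longleftrightarrow> e \<in> B \<or> insert e B \<notin> I"
proof
  assume "e \<in> B \<or> insert e B \<notin> I"
  then show "e \<in> closure_in E I S"
    using B e unfolding closure_in_def basis_of_def by blast
next
  assume "e \<in> closure_in E I S"
  then consider "e \<in> S" | X where "X \<in> I" "X \<subseteq> S" "insert e X \<notin> I"
    unfolding closure_in_def by blast
  then show "e \<in> B \<or> insert e B \<notin> I"
  proof cases
    case 1
    then show ?thesis using B unfolding basis_of_def by blast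
  next
    case 2
    obtain X' where X': "basis_of I S X'" "X \<subseteq> X'"
      using indep_extends_to_basis 2 by blast
    have dep: "insert e X' \<notin> I"
      using 2 X'(2) indep_subset by (meson insert_mono)
    show ?thesis
    proof (rule ccontr)
      assume "\<not> ?thesis"
      then have n: "e \<notin> B" "insert e B \<in> I" by auto
      then have "card X' < card (insert e B)"
        using card_basis_eq[OF X'(1) B] finite_indep B unfolding basis_of_def by simp
      then obtain y where "y \<in> insert e B - X'" "insert y X' \<in> I"
        using augment[of X' "insert e B"] X'(1) n unfolding basis_of_def by blast
      then show False using dep X'(1) B unfolding basis_of_def by blast
    qed
  qed
qed

lemma subset_closure: "S \<subseteq> E \<Longrightarrow> S \<subseteq> closure_in E I S"
  unfolding closure_in_def by blast

lemma closure_mono: "S \<subseteq> T \<Longrightarrow> closure_in E I S \<subseteq> closure_in E I T"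
  unfolding closure_in_def by blast

lemma basis_of_closure_subset:
  assumes B: "basis_of I S B" and "S \<subseteq> T" "T \<subseteq> closure_in E I S"
  shows "basis_of I T B"
proof -
  have "e \<in> B" if "e \<in> T" "insert e B \<in> I" for e
    using in_closure_iff[OF B, of e] that assms(3) unfolding closure_in_def by blast
  then show ?thesis using B \<open>S \<subseteq> T\<close> unfolding basis_of_def by blast
qed

text \<open>A basis of \<open>S\<close> is still a basis of \<open>S \<union> T\<close>, so it
  decides both closures; \<open>T\<close> is enlarged to \<open>S \<union> T\<close> because it need
  not contain \<open>S\<close>.\<close>

lemma closure_least:
  assumes "S \<subseteq> E" "T \<subseteq> closure_in E I S"
  shows "closure_in E I T \<subseteq> closure_in E I S"
proof
  fix e assume "e \<in> closure_in E I T"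
  then have e: "e \<in> E" "e \<in> closure_in E I (S \<union> T)"
    using closure_mono[of T "S \<union> T"] unfolding closure_in_def by blast+
  obtain B where B: "basis_of I S B" using basis_exists .
  then have "basis_of I (S \<union> T) B"
    using basis_of_closure_subset[OF B, of "S \<union> T"] assms subset_closure by blast
  then show "e \<in> closure_in E I S"
    using in_closure_iff B e by blast
qed

section \<open>Circuits and closure\<close>

lemma dependent_contains_circuit:
  assumes "X \<subseteq> E" "X \<notin> I"
  obtains C where "C \<in> circuits E I" "C \<subseteq> X"
proof -
  let ?F = "{Y. Y \<subseteq> X \<and> Y \<notin> I}"
  have "finite ?F" using assms finite_ground finite_subset[of X E] by simp
  moreover have "X \<in> ?F" using assms by blast
  ultimately obtain C where C: "C \<in> ?F" "\<And>Y. Y \<in> ?F \<Longrightarrow> Y \<subseteq> C \<Longrightarrow> Y = C"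
    using finite_has_minimal[of ?F] by (metis (no_types, lifting) empty_iff)
  have "C \<in> circuits E I"
    using C assms unfolding circuits_def by blast
  then show ?thesis using that C(1) by blast
qed

text \<open>A circuit inside \<open>insert e X\<close> with \<open>X\<close> independent must pass
  through \<open>e\<close>; conversely \<open>C - {e}\<close> is an independent witness for the
  closure.\<close>

lemma in_closure_iff_circuit:
  assumes "e \<in> E" "S \<subseteq> E" "e \<notin> S"
  shows "e \<in> closure_in E I S \<longleftrightarrow> (\<exists>C\<in>circuits E I. e \<in> C \<and> C \<subseteq> insert e S)"
proof
  assume "e \<in> closure_in E I S"
  then obtain X where X: "X \<in> I" "X \<subseteq> S" "insert e X \<notin> I"
    using assms unfolding closure_in_def by blast
  moreover obtain C where C: "C \<in> circuits E I" "C \<subseteq> insert e X"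
    using dependent_contains_circuit[of "insert e X"] X assms by blast
  moreover have "e \<in> C"
    using C X(1) indep_subset[of X C] unfolding circuits_def by blast
  ultimately show "\<exists>C\<in>circuits E I. e \<in> C \<and> C \<subseteq> insert e S" by blast
next
  assume "\<exists>C\<in>circuits E I. e \<in> C \<and> C \<subseteq> insert e S"
  then obtain C where C: "C \<in> circuits E I" "e \<in> C" "C \<subseteq> insert e S" by blast
  then have "C - {e} \<in> I" "insert e (C - {e}) \<notin> I" "C - {e} \<subseteq> S"
    by (auto simp: circuits_def insert_absorb)
  then show "e \<in> closure_in E I S" using assms unfolding closure_in_def by blast
qed

end

section \<open>The dual matroid\<close>

context matroid
begin

lemma in_dual_iff: "X \<in> dual E I \<longleftrightarrow> (\<exists>B. basis_of I E B \<and> X \<subseteq> E - B)"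
  unfolding dual_def Bex_def bases_iff by blast

text \<open>If no \<open>y\<close> can be added, every basis avoiding \<open>X\<close> contains
  \<open>Y - X\<close>. The basis \<open>D\<close> below also contains \<open>B' - X\<close>, which
  is disjoint from \<open>Y\<close>, so |Y - X| \<le> |B' \<inter> X|. As \<open>B'\<close> avoids
  \<open>Y\<close>, this is at most |X - Y|, contradicting |X| < |Y|.\<close>

lemma dual_augment:
  assumes "X \<in> dual E I" "Y \<in> dual E I" "card X < card Y"
  shows "\<exists>y\<in>Y - X. insert y X \<in> dual E I"
proof (rule ccontr)
  assume no: "\<not> ?thesis"
  obtain B B' where B: "basis_of I E B" "X \<subseteq> E - B" and B': "basis_of I E B'" "Y \<subseteq> E - B'"
    using assms unfolding in_dual_iff by blast
  have fin: "finite X" "finite Y" "finite B'"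
    using B B' finite_ground finite_subset unfolding basis_of_def by blast+
  \<comment> \<open>Extending \<open>B' - X\<close> by elements of \<open>B\<close> only yields a
    basis of \<open>E\<close> that still avoids \<open>X\<close>.\<close>
  have "B' - X \<in> I" using B'(1) indep_subset unfolding basis_of_def by blast
  then obtain D where D: "basis_of I (B \<union> (B' - X)) D" "B' - X \<subseteq> D"
    using indep_extends_to_basis by (metis Un_upper2)
  have E_closure: "E \<subseteq> closure_in E I (B \<union> (B' - X))"
  proof
    fix e assume "e \<in> E"
    then show "e \<in> closure_in E I (B \<union> (B' - X))"
      using B(1) unfolding closure_in_def basis_of_def by blast
  qed
  have DE: "basis_of I E D"
    using basis_of_closure_subset[OF D(1) _ E_closure] B(1) B'(1) unfolding basis_of_def by blast
  have "X \<inter> D = {}" using D(1) B(2) unfolding basis_of_def by blast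
  have "y \<in> D" if "y \<in> Y - X" for y
  proof (rule ccontr)
    assume "y \<notin> D"
    then have "insert y X \<subseteq> E - D" using that B(2) B'(2) \<open>X \<inter> D = {}\<close> by blast
    then show False using no that DE unfolding in_dual_iff by blast
  qed
  then have "(B' - X) \<union> (Y - X) \<subseteq> D" using D(2) by blast
  moreover have "finite D" using DE finite_indep unfolding basis_of_def by blast
  ultimately have "card ((B' - X) \<union> (Y - X)) \<le> card B'"
    using card_mono card_basis_eq[OF DE B'(1)] by metis
  moreover have "card ((B' - X) \<union> (Y - X)) = card (B' - X) + card (Y - X)"
    using fin B'(2) by (intro card_Un_disjoint) auto
  moreover have "card (B' - X) + card (B' \<inter> X) = card B'"
    using fin by (metis add.commute card_Int_Diff)
  moreover have "card (B' \<inter> X) \<le> card (X - Y)"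
    using fin B'(2) by (intro card_mono) auto
  moreover have "card (X - Y) < card (Y - X)"
  proof -
    have "card X = card (X \<inter> Y) + card (X - Y)" "card Y = card (Y \<inter> X) + card (Y - X)"
      using fin card_Int_Diff by blast+
    then show ?thesis using assms(3) by (simp add: Int_commute)
  qed
  ultimately show False by linarith
qed

lemma matroid_dual: "matroid E (dual E I)"
proof
  show "{} \<in> dual E I"
    using basis_exists[of E] unfolding in_dual_iff by blast
  show "X \<in> dual E I \<Longrightarrow> Y \<subseteq> X \<Longrightarrow> Y \<in> dual E I" for X Y
    unfolding in_dual_iff by blast
qed (use finite_ground dual_augment in \<open>auto simp: dual_def\<close>)

text \<open>The dual rank of \<open>E - A\<close> is the maximum of |E - A - B'| over bases
  \<open>B'\<close>. Since all bases have the same size, this means maximising |B' \<inter> A|,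
  which is bounded by the rank of \<open>A\<close>; a basis extending a basis of \<open>A\<close>
  attains the bound. The additive form avoids truncated subtraction.\<close>

lemma rank_dual_complement:
  assumes "A \<subseteq> E"
  shows "matroid_rank (dual E I) (E - A) + matroid_rank I E = card (E - A) + matroid_rank I A"
proof -
  obtain X where X: "basis_of I A X" using basis_exists .
  then obtain B where B: "basis_of I E B" "X \<subseteq> B"
    using indep_extends_to_basis[of X E] assms unfolding basis_of_def by blast
  have BA: "B \<inter> A = X"
  proof -
    have "a \<in> X" if "a \<in> B \<inter> A" for a
      using X B that indep_subset[of B "insert a X"] unfolding basis_of_def by blast
    then show ?thesis using B X unfolding basis_of_def by blast
  qed
  have fin: "finite (E - A)" "finite B"
    using finite_ground B(1) finite_indep unfolding basis_of_def by auto
  have split: "card (B' \<inter> A) + card (B' - A) = matroid_rank I E" if "basis_of I E B'" for B'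
    using that rank_eq_card_basis[OF that] finite_indep card_Int_Diff
    unfolding basis_of_def by metis
  have diff: "card (E - A - B') + card (B' - A) = card (E - A)" if "B' \<subseteq> E" for B'
  proof -
    have "(E - A) \<inter> B' = B' - A" using that by blast
    then show ?thesis using card_Int_Diff[of "E - A" B'] fin by simp
  qed
  let ?n = "card (E - A - B)"
  have n: "?n + matroid_rank I E = card (E - A) + matroid_rank I A"
    using split[OF B(1)] diff[of B] B(1) BA rank_eq_card_basis[OF X]
    unfolding basis_of_def by simp
  have "matroid_rank (dual E I) (E - A) = ?n"
    unfolding matroid_rank_def
  proof (rule Max_eqI)
    show "finite (card ` {Z \<in> dual E I. Z \<subseteq> E - A})" using fin by simp
    have "E - A - B \<in> dual E I" using B(1) unfolding in_dual_iff by blast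
    then show "?n \<in> card ` {Z \<in> dual E I. Z \<subseteq> E - A}" by blast
  next
    fix k assume "k \<in> card ` {Z \<in> dual E I. Z \<subseteq> E - A}"
    then obtain Z B' where Z: "k = card Z" "Z \<subseteq> E - A" "basis_of I E B'" "Z \<subseteq> E - B'"
      unfolding in_dual_iff by blast
    have "k \<le> card (E - A - B')" using Z fin by (auto intro!: card_mono)
    moreover have "card (B' \<inter> A) \<le> matroid_rank I A"
      using Z(3) indep_subset[of B' "B' \<inter> A"] unfolding basis_of_def
      by (intro card_indep_le_rank) auto
    moreover have "B' \<subseteq> E" using Z(3) unfolding basis_of_def by blast
    ultimately show "k \<le> ?n" using n split[OF Z(3)] diff[of B'] by linarith
  qed
  then show ?thesis using n by simp
qed

lemma corank_eq_nullity_dual: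
  "A \<subseteq> E \<Longrightarrow> corank E I A = nullity (dual E I) (E - A)"
  using rank_dual_complement[of A] unfolding corank_def nullity_def by linarith

end

section \<open>Active elements\<close>

locale ordered_matroid = matroid E I for E :: "'a::linorder set" and I
begin

text \<open>If \<open>e\<close> is the minimum of a circuit inside \<open>A \<union> {e}\<close>,
  the other elements of the circuit are exactly elements of \<open>A\<close> above \<open>e\<close>.
  Taking \<open>e\<close> inside or outside \<open>A\<close> gives \<open>Q_set\<close> or
  \<open>Ext_set\<close>.\<close>

lemma active_iff_circuit:
  assumes "e \<in> E" "A \<subseteq> E"
  shows "e \<in> active_set E I A \<longleftrightarrow> (\<exists>C\<in>circuits E I. C \<subseteq> A \<union> {e} \<and> smallest_in e C)"
proof -
  have "e \<in> C \<and> C \<subseteq> insert e (A \<inter> {e<..}) \<longleftrightarrow> C \<subseteq> A \<union> {e} \<and> smallest_in e C" for C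
    unfolding smallest_in_def by (auto simp: less_le)
  moreover have "e \<in> active_set E I A \<longleftrightarrow>
      (\<exists>C\<in>circuits E I. e \<in> C \<and> C \<subseteq> insert e (A \<inter> {e<..}))"
    using in_closure_iff_circuit[of e "A \<inter> {e<..}"] assms unfolding active_set_def by auto
  ultimately show ?thesis by simp
qed

lemma active_set_subset: "active_set E I A \<subseteq> E"
  unfolding active_set_def by blast

lemma Q_set_eq: "A \<subseteq> E \<Longrightarrow> Q_set E I A = A \<inter> active_set E I A"
  using active_iff_circuit[of _ A] unfolding Q_set_def by (auto simp: insert_absorb)

lemma Ext_set_eq: "A \<subseteq> E \<Longrightarrow> Ext_set E I A = active_set E I A - A"
  using active_iff_circuit[of _ A] active_set_subset[of A] unfolding Ext_set_def by auto

lemma phi_eq: "A \<subseteq> E \<Longrightarrow> phi E I N A = (A - active_set E I A) \<union> (active_set E I A - A)"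
  unfolding phi_def by (auto simp: Q_set_eq Ext_set_eq)

text \<open>An active \<open>x\<close> is spanned by the elements of \<open>A\<close> above it,
  which stay in the up-closed set \<open>U\<close> and are already spanned by inactive ones. Open
  segments serve the invariance of \<open>active_set\<close>, and \<open>UNIV\<close> serves the
  nullity count.\<close>

lemma upper_segment_subset_closure:
  assumes "A \<subseteq> E" and up: "\<And>x y. x \<in> U \<Longrightarrow> x < y \<Longrightarrow> y \<in> U"
  shows "A \<inter> U \<subseteq> closure_in E I ((A - active_set E I A) \<inter> U)"
proof
  let ?S = "(A - active_set E I A) \<inter> U"
  have finA: "finite A" using assms finite_ground finite_subset by blast
  fix x assume "x \<in> A \<inter> U"
  then show "x \<in> closure_in E I ?S"
  \<comment> \<open>The measure makes the induction run downwards from the largest elements of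
    \<open>A\<close>.\<close>
  proof (induction "card (A \<inter> {x<..})" arbitrary: x rule: less_induct)
    case less
    show ?case
    proof (cases "x \<in> active_set E I A")
      case False
      then show ?thesis using less.prems assms subset_closure[of ?S] by blast
    next
      case True
      have "A \<inter> {x<..} \<subseteq> closure_in E I ?S"
      proof
        fix y assume y: "y \<in> A \<inter> {x<..}"
        then have "A \<inter> {y<..} \<subset> A \<inter> {x<..}" by auto
        then have "card (A \<inter> {y<..}) < card (A \<inter> {x<..})"
          using finA by (intro psubset_card_mono) auto
        then show "y \<in> closure_in E I ?S" using less y up by auto
      qed
      then have "closure_in E I (A \<inter> {x<..}) \<subseteq> closure_in E I ?S"
        using assms by (intro closure_least) auto
      then show ?thesis using True unfolding active_set_def by blast
    qed
  qed
qed

text \<open>Above any \<open>e\<close>, elements of \<open>B - A\<close> are active and hence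
  spanned by larger elements of \<open>A\<close>; conversely \<open>A\<close> is spanned there by
  its inactive elements, all of which lie in \<open>B\<close>. So the two closures agree.\<close>

lemma active_set_cong:
  assumes "A \<subseteq> E" "B \<subseteq> E"
    and "A - active_set E I A \<subseteq> B" "B \<subseteq> A \<union> active_set E I A"
  shows "active_set E I B = active_set E I A"
proof -
  have "closure_in E I (B \<inter> {e<..}) = closure_in E I (A \<inter> {e<..})" for e
  proof
    have "B \<inter> {e<..} \<subseteq> closure_in E I (A \<inter> {e<..})"
    proof
      fix x assume x: "x \<in> B \<inter> {e<..}"
      show "x \<in> closure_in E I (A \<inter> {e<..})"
      proof (cases "x \<in> A")
        case True
        then show ?thesis using x assms unfolding closure_in_def by blast
      next
        case False
        then have "x \<in> closure_in E I (A \<inter> {x<..})"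
          using x assms unfolding active_set_def by blast
        moreover have "A \<inter> {x<..} \<subseteq> A \<inter> {e<..}" using x by auto
        ultimately show ?thesis using closure_mono by blast
      qed
    qed
    then show "closure_in E I (B \<inter> {e<..}) \<subseteq> closure_in E I (A \<inter> {e<..})"
      using assms by (intro closure_least) auto
    have "A \<inter> {e<..} \<subseteq> closure_in E I ((A - active_set E I A) \<inter> {e<..})"
      using assms by (intro upper_segment_subset_closure) auto
    also have "\<dots> \<subseteq> closure_in E I (B \<inter> {e<..})"
      using assms by (intro closure_mono) auto
    finally show "closure_in E I (A \<inter> {e<..}) \<subseteq> closure_in E I (B \<inter> {e<..})"
      using assms by (intro closure_least) auto
  qed
  then show ?thesis unfolding active_set_def by simp
qed

section \<open>The involution and the exchange of \<open>Q_set\<close> with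
  \<open>Ext_set\<close>\<close>

lemma phi_subset: "A \<subseteq> E \<Longrightarrow> phi E I N A \<subseteq> E"
  using active_set_subset[of A] by (auto simp: phi_eq)

text \<open>\<open>phi\<close> toggles active elements only. With the active set fixed, involutivity
  and the exchange reduce to set algebra.\<close>

lemma active_set_phi:
  assumes "A \<subseteq> E"
  shows "active_set E I (phi E I N A) = active_set E I A"
  by (rule active_set_cong[OF assms phi_subset[OF assms]]) (unfold phi_eq[OF assms], blast+)

lemma phi_phi:
  assumes "A \<subseteq> E"
  shows "phi E I N (phi E I N A) = A"
  unfolding phi_eq[OF phi_subset[OF assms]] active_set_phi[OF assms]
  unfolding phi_eq[OF assms] by blast

lemma Q_set_phi:
  assumes "A \<subseteq> E"
  shows "Q_set E I (phi E I N A) = Ext_set E I A"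
  unfolding Q_set_eq[OF phi_subset[OF assms]] active_set_phi[OF assms] Ext_set_eq[OF assms]
  unfolding phi_eq[OF assms] by blast

lemma Ext_set_phi:
  assumes "A \<subseteq> E"
  shows "Ext_set E I (phi E I N A) = Q_set E I A"
  unfolding Ext_set_eq[OF phi_subset[OF assms]] active_set_phi[OF assms] Q_set_eq[OF assms]
  unfolding phi_eq[OF assms] by blast

text \<open>A circuit among the inactive elements of \<open>A\<close> would make its own minimum
  active.\<close>

lemma indep_diff_active:
  assumes "A \<subseteq> E"
  shows "A - active_set E I A \<in> I"
proof (rule ccontr)
  assume "A - active_set E I A \<notin> I"
  then obtain C where C: "C \<in> circuits E I" "C \<subseteq> A - active_set E I A"
    using dependent_contains_circuit[of "A - active_set E I A"] assms
    by (metis Diff_subset subset_trans)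
  have "C \<noteq> {}" "finite C"
    using C(1) empty_indep finite_ground finite_subset unfolding circuits_def by blast+
  then have min: "Min C \<in> C" "smallest_in (Min C) C" unfolding smallest_in_def by auto
  then have "Min C \<in> E" "C \<subseteq> A \<union> {Min C}" using C assms by blast+
  then have "Min C \<in> active_set E I A"
    using active_iff_circuit[of "Min C" A] C(1) min(2) assms by blast
  then show False using C(2) min(1) by blast
qed

lemma nullity_eq_card_Q:
  assumes "A \<subseteq> E"
  shows "nullity I A = int (card (Q_set E I A))"
proof -
  let ?X = "A - active_set E I A"
  have "basis_of I ?X ?X"
    using indep_diff_active[OF assms] unfolding basis_of_def by blast
  \<comment> \<open>Independent and spanning, the inactive elements form a basis of
    \<open>A\<close>; the rest of \<open>A\<close> is \<open>Q_set\<close>.\<close>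
  moreover have "A \<subseteq> closure_in E I ?X"
    using upper_segment_subset_closure[OF assms, of UNIV] by simp
  ultimately have "basis_of I A ?X"
    using basis_of_closure_subset by (metis Diff_subset)
  then have "matroid_rank I A = card ?X" by (rule rank_eq_card_basis)
  moreover have "card A = card (A \<inter> active_set E I A) + card ?X"
    using assms finite_ground finite_subset card_Int_Diff by blast
  ultimately show ?thesis unfolding nullity_def Q_set_eq[OF assms] by simp
qed

lemma nullity_phi: "A \<subseteq> E \<Longrightarrow> nullity I (phi E I N A) = int (ext_activity E I A)"
  by (simp add: nullity_eq_card_Q phi_subset Q_set_phi ext_activity_def)

lemma ext_activity_phi: "A \<subseteq> E \<Longrightarrow> int (ext_activity E I (phi E I N A)) = nullity I A"
  by (simp add: nullity_eq_card_Q Ext_set_phi ext_activity_def)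

end

section \<open>Duality\<close>

lemma P_set_eq_Q_set_dual: "P_set E N A = Q_set E (dual E N) (E - A)"
  unfolding P_set_def Q_set_def cocircuits_def by simp

lemma Int_set_eq_Ext_set_dual: "A \<subseteq> E \<Longrightarrow> Int_set E N A = Ext_set E (dual E N) (E - A)"
  unfolding Int_set_def Ext_set_def cocircuits_def by (auto simp: double_diff)

lemma int_activity_eq_ext_activity_dual:
  "A \<subseteq> E \<Longrightarrow> int_activity E N A = ext_activity E (dual E N) (E - A)"
  by (simp add: int_activity_def ext_activity_def Int_set_eq_Ext_set_dual)

text \<open>Adding \<open>P_set\<close> to \<open>A\<close> removes the dual \<open>Q_set\<close>
  from the complement, and removing \<open>Int_set\<close> from \<open>A\<close> adds the dual
  \<open>Ext_set\<close> there.\<close>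

lemma phi_star_eq_phi_dual:
  assumes "A \<subseteq> E"
  shows "phi_star E M M' A = E - phi E (dual E M') N (E - A)"
  using assms unfolding phi_star_def phi_def P_set_eq_Q_set_dual Int_set_eq_Ext_set_dual[OF assms]
  by (auto simp: Q_set_def Ext_set_def)

theorem theorem5:
  fixes E :: "'a::linorder set" and M M' :: "'a set set"
  assumes "matroid_perspective E M M'"
  shows "involution_on (Pow E) (phi_star E M M')
    \<and> involution_on (Pow E) (phi E M M')
    \<and> (\<forall>A \<subseteq> E.
          corank E M' (phi_star E M M' A) = int (int_activity E M' A)
        \<and> int (int_activity E M' (phi_star E M M' A)) = corank E M' A
        \<and> nullity M (phi E M M' A) = int (ext_activity E M A)
        \<and> int (ext_activity E M (phi E M M' A)) = nullity M A)"
proof -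
  interpret M: ordered_matroid E M
    using assms unfolding matroid_perspective_def ordered_matroid_def by blast
  interpret M': matroid E M'
    using assms unfolding matroid_perspective_def by blast
  interpret D: ordered_matroid E "dual E M'"
    using M'.matroid_dual unfolding ordered_matroid_def .
  let ?\<psi> = "phi E (dual E M') M"
  have star: "phi_star E M M' A = E - ?\<psi> (E - A)" if "A \<subseteq> E" for A
    using phi_star_eq_phi_dual[OF that] .
  have star_subset: "phi_star E M M' A \<subseteq> E" if "A \<subseteq> E" for A
    using star[OF that] by blast
  \<comment> \<open>Corank and internal activity of a set are the dual nullity and external activity
    of its complement, so the complement of the image is what has to be known.\<close>
  have compl_star: "E - phi_star E M M' A = ?\<psi> (E - A)" if "A \<subseteq> E" for A
    using star[OF that] D.phi_subset[of "E - A" M] by (simp add: double_diff)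
  have "phi_star E M M' (phi_star E M M' A) = A" if "A \<subseteq> E" for A
    using that by (subst star) (auto simp: star_subset compl_star D.phi_phi)
  then have "involution_on (Pow E) (phi_star E M M')"
    using star_subset unfolding involution_on_def by simp
  moreover have "involution_on (Pow E) (phi E M M')"
    unfolding involution_on_def by (simp add: M.phi_subset M.phi_phi)
  ultimately show ?thesis
    by (simp add: M.nullity_phi M.ext_activity_phi M'.corank_eq_nullity_dual
        int_activity_eq_ext_activity_dual star_subset compl_star D.nullity_phi D.ext_activity_phi)
qed

end
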